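(* Let $(f_k(t))_{k=0,\ldots,n}$, $t\in[0,1]$, be a constant speed path with speed $v>0$ and coefficients $\boldsymbol\alpha(t)\in\mathcal A$, where $f_k(t)>0$ for all $k\in\{0,\ldots,n\}$ and all $t$, the functions $t\mapsto f_k(t)$ are twice continuously differentiable and the functions $t\mapsto\alpha_k(t)$ are continuously differentiable. Let $t^*\in(0,1)$ and suppose that at $t=t^*$ the following three conditions hold: (1) ($k$-monotonicity) $\alpha_k(t^* )\le\alpha_{k+1}(t^* )$ for all $k=0,\ldots,n-1$; (2) ($t$-monotonicity) $\frac{\partial\alpha_k}{\partial t}(t^* )\ge 0$ for all $k=0,\ldots,n$; (3) (GLC) for all $k=0,\ldots,n-2$, $$\alpha_{k+1}(1-\alpha_{k+1})f_{k+1}^2-\alpha_{k+2}(1-\alpha_k)f_kf_{k+2}\ge 0$$ (all quantities evaluated at $t^*$). Then the entropy $H(t)=-\sum_{k=0}^n f_k(t)\log f_k(t)$ satisfies $H''(t^* )\le 0$.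
   Context: Fix an integer $n\ge1$. For a sequence $(a_k)_{k\in\mathbb Z}$ write $\nabla_1 a_k=a_k-a_{k-1}$. Functions indexed by $k$ are extended by $0$ outside their stated index range. $\mathcal A$ denotes the set of measurable $\boldsymbol\alpha(t)=(\alpha_0(t),\ldots,\alpha_n(t))$, $t\in[0,1]$, with $\alpha_0\equiv0$, $\alpha_n\equiv1$ and $0\le\alpha_k(t)\le1$ for all $k,t$. A family $(f_k(t))_{k=0,\ldots,n}$ of probability mass functions on $\{0,\ldots,n\}$ is a constant speed path with speed $v\in\mathbb R$ and coefficients $\boldsymbol\alpha\in\mathcal A$ if $\frac{\partial f_k}{\partial t}(t)=-v\,\nabla_1 g_k(t)$ for $k=0,\ldots,n$, where $g_k(t)=\alpha_{k+1}(t)f_{k+1}(t)+(1-\alpha_k(t))f_k(t)$ for $k=0,\ldots,n-1$ and $g_k=0$ for $k\notin\{0,\ldots,n-1\}$. *)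

theory Defs
  imports "HOL-Analysis.Analysis"
begin

text \<open>Flux g_k(t) = alpha_{k+1}(t) f_{k+1}(t) + (1 - alpha_k(t)) f_k(t) for k = 0..n-1,
  and 0 otherwise (indices are natural numbers; g_{-1} = 0 is handled in nabla_g).\<close>
definition flux :: "nat \<Rightarrow> (nat \<Rightarrow> real \<Rightarrow> real) \<Rightarrow> (nat \<Rightarrow> real \<Rightarrow> real) \<Rightarrow> nat \<Rightarrow> real \<Rightarrow> real" where
  "flux n \<alpha> f k t = (if k < n then \<alpha> (Suc k) t * f (Suc k) t + (1 - \<alpha> k t) * f k t else 0)"

definition nabla_flux :: "nat \<Rightarrow> (nat \<Rightarrow> real \<Rightarrow> real) \<Rightarrow> (nat \<Rightarrow> real \<Rightarrow> real) \<Rightarrow> nat \<Rightarrow> real \<Rightarrow> real" where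
  "nabla_flux n \<alpha> f k t = flux n \<alpha> f k t - (if k = 0 then 0 else flux n \<alpha> f (k - 1) t)"

definition coeff_class :: "nat \<Rightarrow> (nat \<Rightarrow> real \<Rightarrow> real) \<Rightarrow> bool" where
  "coeff_class n \<alpha> \<longleftrightarrow>
     (\<forall>k\<le>n. set_borel_measurable lborel {0..1} (\<alpha> k)) \<and>
     (\<forall>t\<in>{0..1}. \<alpha> 0 t = 0 \<and> \<alpha> n t = 1 \<and> (\<forall>k\<le>n. 0 \<le> \<alpha> k t \<and> \<alpha> k t \<le> 1))"

definition pmf_family :: "nat \<Rightarrow> (nat \<Rightarrow> real \<Rightarrow> real) \<Rightarrow> bool" where
  "pmf_family n f \<longleftrightarrow> (\<forall>t\<in>{0..1}. (\<forall>k\<le>n. 0 \<le> f k t) \<and> (\<Sum>k\<le>n. f k t) = 1)"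

definition constant_speed_path ::
  "nat \<Rightarrow> real \<Rightarrow> (nat \<Rightarrow> real \<Rightarrow> real) \<Rightarrow> (nat \<Rightarrow> real \<Rightarrow> real) \<Rightarrow> bool" where
  "constant_speed_path n v \<alpha> f \<longleftrightarrow>
     pmf_family n f \<and> coeff_class n \<alpha> \<and>
     (\<forall>k\<le>n. \<forall>t\<in>{0..1}.
        (f k has_real_derivative (- v * nabla_flux n \<alpha> f k t)) (at t within {0..1}))"

definition C1_on_real :: "real set \<Rightarrow> (real \<Rightarrow> real) \<Rightarrow> bool" where
  "C1_on_real S h \<longleftrightarrow> (\<exists>h'. (\<forall>t\<in>S. (h has_real_derivative h' t) (at t within S)) \<and> continuous_on S h')"

definition C2_on_real :: "real set \<Rightarrow> (real \<Rightarrow> real) \<Rightarrow> bool" where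
  "C2_on_real S h \<longleftrightarrow> (\<exists>h' h''. (\<forall>t\<in>S. (h has_real_derivative h' t) (at t within S)) \<and>
      (\<forall>t\<in>S. (h' has_real_derivative h'' t) (at t within S)) \<and> continuous_on S h'')"

definition entropy :: "nat \<Rightarrow> (nat \<Rightarrow> real \<Rightarrow> real) \<Rightarrow> real \<Rightarrow> real" where
  "entropy n f t = - (\<Sum>k\<le>n. f k t * ln (f k t))"

end

theory Submission
  imports Defs
begin

text \<open>
  Put h_k = alpha_{k+1} g_{k+1} + (1 - alpha_{k+1}) g_k. Then g_k' is -v times the backward
  difference of h_k - alpha_{k+1}' f_{k+1} / v, so that two summations by parts express H'' through
  h_k log (f_{k+1}^2 / (f_k f_{k+2})) and the squares (nabla_1 g_k)^2 / f_k. Since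
  h_k f_{k+1} - g_k g_{k+1} = alpha_{k+1} (1 - alpha_{k+1}) f_{k+1}^2
  - alpha_{k+2} (1 - alpha_k) f_k f_{k+2}, condition GLC says h_k f_{k+1} >= g_k g_{k+1}. Together
  with k-monotonicity it gives log-concavity wherever 0 < alpha_{k+1} < 1, and there
    h_k (f_{k+1}^2 - f_k f_{k+2}) <= 2 g_k g_{k+1} f_{k+1} - g_k^2 f_{k+2} - g_{k+1}^2 f_k.
  With 2 log s <= s - 1/s for s >= 1 this bounds the logarithmic term by
  g_k^2 / f_k + g_{k+1}^2 / f_{k+2} - 2 g_k g_{k+1} / f_{k+1}, and these bounds add up to at most the
  sum of squares. If alpha_{k+1} is 0 or 1, then h_k f_{k+1} = g_k g_{k+1} and log s <= s - 1
  suffices; moreover alpha_{k+1}' vanishes there, as t* is an interior extremum of alpha_{k+1}.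
\<close>

section \<open>Scalar inequalities for three consecutive masses\<close>

lemma two_ln_le_diff_inverse:
  fixes s :: real
  assumes "1 \<le> s"
  shows "2 * ln s \<le> s - 1 / s"
proof -
  let ?\<phi> = "\<lambda>x::real. x - 1 / x - 2 * ln x"
  \<comment> \<open>\<open>?\<phi>\<close> vanishes at 1, and its derivative is a perfect
    square.\<close>
  have "?\<phi> 1 \<le> ?\<phi> s"
  proof (rule DERIV_nonneg_imp_nondecreasing[OF assms])
    fix x :: real
    assume "1 \<le> x" "x \<le> s"
    then have "(?\<phi> has_real_derivative (1 - 1 / x)\<^sup>2) (at x)"
      by (auto intro!: derivative_eq_intros simp: power2_eq_square field_simps)
    then show "\<exists>y. (?\<phi> has_real_derivative y) (at x) \<and> 0 \<le> y"
      by (meson zero_le_power2)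
  qed
  then show ?thesis by simp
qed

text \<open>In GLC, lower \<open>1 - a\<close> to \<open>1 - b\<close> and cancel
  \<open>1 - b\<close>, or lower \<open>c\<close> to \<open>b\<close> and cancel \<open>b\<close>;
  both cancellations rely on \<open>0 < b < 1\<close>. Log-concavity then follows from the first
  bound and \<open>b \<le> c\<close>.\<close>

lemma GLC_imp_ratio_bounds:
  fixes a b c x y z :: real
  assumes pos: "0 < x" "0 < y" "0 < z"
    and ord: "0 \<le> a" "a \<le> b" "b \<le> c" "c \<le> 1" and b: "0 < b" "b < 1"
    and glc: "c * (1 - a) * x * z \<le> b * (1 - b) * y\<^sup>2"
  shows "c * (x * z) \<le> b * y\<^sup>2" "(1 - a) * (x * z) \<le> (1 - b) * y\<^sup>2" "x * z \<le> y\<^sup>2"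
proof -
  have xz: "0 < x * z" using pos by simp
  have "(1 - b) * (c * (x * z)) \<le> (1 - a) * (c * (x * z))"
    using ord xz b by (intro mult_right_mono) auto
  also have "\<dots> \<le> (1 - b) * (b * y\<^sup>2)" using glc by (simp add: algebra_simps)
  finally show c: "c * (x * z) \<le> b * y\<^sup>2" using b by simp
  have "b * ((1 - a) * (x * z)) \<le> c * ((1 - a) * (x * z))"
    using ord xz b by (intro mult_right_mono) auto
  also have "\<dots> \<le> b * ((1 - b) * y\<^sup>2)" using glc by (simp add: algebra_simps)
  finally show "(1 - a) * (x * z) \<le> (1 - b) * y\<^sup>2" using b by simp
  have "b * (x * z) \<le> c * (x * z)" using ord xz by (intro mult_right_mono) auto
  with c have "b * (x * z) \<le> b * y\<^sup>2" by linarith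
  then show "x * z \<le> y\<^sup>2" using b by simp
qed

text \<open>After multiplication by \<open>y\<close>, the gap between the two sides is a nonnegative
  combination of the slacks \<open>?P\<close> and \<open>?Q\<close> of the ratio bounds, weighted by
  the increments \<open>c - b\<close> and \<open>b - a\<close>, plus a nonnegative term.\<close>

lemma GLC_imp_cubic_bound:
  fixes a b c x y z :: real
  assumes pos: "0 < x" "0 < y" "0 < z"
    and ord: "0 \<le> a" "a \<le> b" "b \<le> c" "c \<le> 1" and b: "0 < b" "b < 1"
    and glc: "c * (1 - a) * x * z \<le> b * (1 - b) * y\<^sup>2"
    and p: "p = b * y + (1 - a) * x" and q: "q = c * z + (1 - b) * y"
  shows "(b * q + (1 - b) * p) * (y\<^sup>2 - x * z) \<le> 2 * p * q * y - p\<^sup>2 * z - q\<^sup>2 * x"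
proof -
  let ?P = "b * y\<^sup>2 - c * (x * z)" and ?Q = "(1 - b) * y\<^sup>2 - (1 - a) * (x * z)"
  note rb = GLC_imp_ratio_bounds[OF pos ord b glc]
  have "0 \<le> ?P * ((c - b) * y * z) + ?Q * ((b - a) * x * y) + 2 * ((c - b) * (b - a) * x * y\<^sup>2 * z)"
    using rb ord pos by simp
  also have "\<dots> = y * (2 * p * q * y - p\<^sup>2 * z - q\<^sup>2 * x
      - (b * q + (1 - b) * p) * (y\<^sup>2 - x * z))"
    unfolding p q by (simp add: power2_eq_square algebra_simps)
  finally show ?thesis using pos by (simp add: zero_le_mult_iff)
qed

text \<open>Here \<open>x\<close>, \<open>y\<close>, \<open>z\<close> stand for three consecutive
  masses, \<open>a\<close>, \<open>b\<close>, \<open>c\<close> for their coefficients, and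
  \<open>p\<close>, \<open>q\<close> for the two fluxes between them. For \<open>0 < b < 1\<close>
  the cubic bound applies; otherwise GLC holds with equality.\<close>

lemma flux_log_bound:
  fixes a b c x y z :: real
  assumes pos: "0 < x" "0 < y" "0 < z"
    and ord: "0 \<le> a" "a \<le> b" "b \<le> c" "c \<le> 1"
    and glc: "c * (1 - a) * x * z \<le> b * (1 - b) * y\<^sup>2"
    and p: "p = b * y + (1 - a) * x" and q: "q = c * z + (1 - b) * y"
  shows "(b * q + (1 - b) * p) * ln (y\<^sup>2 / (x * z)) \<le> p\<^sup>2 / x + q\<^sup>2 / z - 2 * p * q / y"
proof -
  let ?h = "b * q + (1 - b) * p"
  \<comment> \<open>At \<open>b = 0\<close> the ordering forces \<open>a = 0\<close>, hence
    \<open>p = x\<close>; likewise \<open>b = 1\<close> forces \<open>c = 1\<close> and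
    \<open>q = z\<close> below.\<close>
  have p0: "0 < p"
  proof (cases "b = 0")
    case True
    then show ?thesis using ord pos p by simp
  next
    case False
    then have "0 < b * y" "0 \<le> (1 - a) * x" using ord pos by auto
    then show ?thesis using p by linarith
  qed
  have q0: "0 < q"
  proof (cases "b = 1")
    case True
    then show ?thesis using ord pos q by simp
  next
    case False
    then have "0 < (1 - b) * y" "0 \<le> c * z" using ord pos by auto
    then show ?thesis using q by linarith
  qed
  show ?thesis
  proof (cases "0 < b \<and> b < 1")
    case False
    then have "b * (1 - b) = 0" using ord by auto
    moreover have "0 \<le> c * (1 - a) * x * z" using pos ord by simp
    moreover have "?h * y = p * q + (b * (1 - b) * y\<^sup>2 - c * (1 - a) * x * z)"
      unfolding p q by (simp add: power2_eq_square algebra_simps)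
    ultimately have "?h * y = p * q" using glc by (simp only:)
    then have h: "?h = p * q / y" using pos by (simp add: field_simps)
    \<comment> \<open>The factors are chosen so that multiplying them by \<open>p * q / y\<close>
      gives exactly \<open>p\<^sup>2 / x\<close> and \<open>q\<^sup>2 / z\<close>.\<close>
    have "ln (y\<^sup>2 / (x * z)) = ln (y * p / (x * q)) + ln (y * q / (z * p))"
      using pos p0 q0 by (simp add: ln_div ln_mult ln_realpow)
    also have "\<dots> \<le> (y * p / (x * q) - 1) + (y * q / (z * p) - 1)"
      using pos p0 q0 by (intro add_mono ln_le_minus_one) auto
    finally have "?h * ln (y\<^sup>2 / (x * z))
        \<le> p * q / y * ((y * p / (x * q) - 1) + (y * q / (z * p) - 1))"
      unfolding h using pos p0 q0 by (intro mult_left_mono) auto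
    also have "\<dots> = p\<^sup>2 / x + q\<^sup>2 / z - 2 * p * q / y"
      using pos p0 q0 by (simp add: field_simps power2_eq_square)
    finally show ?thesis .
  next
    case True
    then have b: "0 < b" "b < 1" by auto
    \<comment> \<open>With the geometric mean \<open>w\<close> the logarithm becomes
      \<open>2 * ln (y / w)\<close>, where \<open>y / w\<close> is at least 1 by
      log-concavity.\<close>
    define w where "w = sqrt (x * z)"
    define N where "N = p\<^sup>2 * z + q\<^sup>2 * x"
    have w: "0 < w" "w\<^sup>2 = x * z" using pos by (auto simp: w_def)
    have wy: "w \<le> y"
      using GLC_imp_ratio_bounds(3)[OF pos ord b glc] w pos power2_le_imp_le[of w y] by simp
    have h0: "0 \<le> ?h" using b p0 q0 by simp
    \<comment> \<open>AM-GM for the two terms of \<open>N\<close>, in squared form.\<close>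
    have "(2 * p * q * w)\<^sup>2 \<le> N\<^sup>2"
    proof -
      have "N\<^sup>2 - (2 * p * q * w)\<^sup>2 = (p\<^sup>2 * z - q\<^sup>2 * x)\<^sup>2"
        unfolding N_def power_mult_distrib w(2) by (simp add: power2_eq_square algebra_simps)
      then show ?thesis using zero_le_power2[of "p\<^sup>2 * z - q\<^sup>2 * x"] by linarith
    qed
    then have N: "2 * p * q * w \<le> N"
      using pos by (intro power2_le_imp_le[of "2 * p * q * w" N]) (auto simp: N_def)
    have "ln (y\<^sup>2 / (x * z)) = 2 * ln (y / w)"
      using pos w by (simp flip: w(2) add: ln_div ln_realpow)
    also have "\<dots> \<le> y / w - 1 / (y / w)"
      using wy w by (intro two_ln_le_diff_inverse) simp
    also have "\<dots> = (y\<^sup>2 - x * z) / (y * w)"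
      using pos w(1) by (simp flip: w(2) add: field_simps power2_eq_square)
    finally have "?h * ln (y\<^sup>2 / (x * z)) \<le> ?h * (y\<^sup>2 - x * z) / (y * w)"
      using mult_left_mono[OF _ h0] by fastforce
    also have "\<dots> \<le> (2 * p * q * y - N) / (y * w)"
      using GLC_imp_cubic_bound[OF pos ord b glc p q] pos w
      by (intro divide_right_mono) (auto simp: N_def)
    also have "\<dots> \<le> N / w\<^sup>2 - 2 * p * q / y"
    proof -
      have "N / w\<^sup>2 - 2 * p * q / y - (2 * p * q * y - N) / (y * w)
          = (N - 2 * p * q * w) * (y + w) / (y * w\<^sup>2)"
        using pos w(1) by (simp add: field_simps power2_eq_square)
      moreover have "0 \<le> \<dots>" using N pos w(1) by simp
      ultimately show ?thesis by linarith
    qed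
    also have "N / w\<^sup>2 = p\<^sup>2 / x + q\<^sup>2 / z"
      using pos by (simp add: N_def w(2) field_simps)
    finally show ?thesis .
  qed
qed

section \<open>Summation by parts\<close>

lemma sum_by_parts_backward_diff:
  fixes c G :: "nat \<Rightarrow> 'a::comm_ring"
  shows "(\<Sum>k\<le>n. c k * (G k - (if k = 0 then 0 else G (k - 1))))
    = (\<Sum>k<n. G k * (c k - c (Suc k))) + c n * G n"
  by (induction n) (auto simp: algebra_simps)

lemma sum_by_parts_forward_diff:
  fixes e H :: "nat \<Rightarrow> 'a::comm_ring"
  shows "(\<Sum>k<Suc m. (H (Suc k) - H k) * e k)
    = (\<Sum>k<m. H (Suc k) * (e k - e (Suc k))) + H (Suc m) * e m - H 0 * e 0"
  by (induction m) (auto simp: algebra_simps)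

text \<open>Expanding the squares puts each \<open>(G k)\<^sup>2\<close> over both
  \<open>f k\<close> and \<open>f (Suc k)\<close>. Regrouping by neighbouring pairs, in the shape of
  the bound in \<open>flux_log_bound\<close>, leaves over only the two end terms on the
  right.\<close>

lemma sum_sq_backward_diff:
  fixes G f :: "nat \<Rightarrow> real"
  shows "(\<Sum>k\<le>m. (G k - (if k = 0 then 0 else G (k - 1)))\<^sup>2 / f k) + (G m)\<^sup>2 / f (Suc m)
    = (\<Sum>k<m. (G k)\<^sup>2 / f k + (G (Suc k))\<^sup>2 / f (k + 2) - 2 * G k * G (Suc k) / f (Suc k))
      + (G m)\<^sup>2 / f m + (G 0)\<^sup>2 / f 1"
  by (induction m)
    (auto simp: power2_diff add_divide_distrib diff_divide_distrib algebra_simps)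

section \<open>Derivatives at an interior time\<close>

lemma deriv_eq_0_at_boundary_value:
  fixes h :: "real \<Rightarrow> real"
  assumes "(h has_real_derivative D) (at t)" "0 < t" "t < 1"
    and "\<And>s. s \<in> {0..1} \<Longrightarrow> 0 \<le> h s \<and> h s \<le> 1"
    and "h t = 0 \<or> h t = 1"
  shows "D = 0"
proof -
  have d: "0 < min t (1 - t)" using assms by simp
  have bounds: "0 \<le> h s \<and> h s \<le> 1" if "\<bar>t - s\<bar> < min t (1 - t)" for s
    using that by (intro assms(4)) auto
  show ?thesis
    using assms(5)
  proof
    assume "h t = 0"
    with bounds show ?thesis by (intro DERIV_local_min[OF assms(1) d]) auto
  next
    assume "h t = 1"
    with bounds show ?thesis by (intro DERIV_local_max[OF assms(1) d]) auto
  qed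
qed

lemma has_real_derivative_entropy:
  fixes f :: "nat \<Rightarrow> real \<Rightarrow> real"
  assumes "\<And>k. k \<le> n \<Longrightarrow> (f k has_real_derivative d k) (at t)"
    and "\<And>k. k \<le> n \<Longrightarrow> 0 < f k t"
  shows "(entropy n f has_real_derivative - (\<Sum>k\<le>n. d k * (ln (f k t) + 1))) (at t)"
proof -
  have "((\<lambda>t. - (\<Sum>k\<le>n. f k t * ln (f k t))) has_real_derivative
      - (\<Sum>k\<le>n. d k * (ln (f k t) + 1))) (at t)"
    using assms
    by (intro DERIV_minus DERIV_sum)
      (auto intro!: derivative_eq_intros simp: algebra_simps less_imp_neq[THEN not_sym])
  then show ?thesis unfolding entropy_def[abs_def] .
qed

text \<open>The first-derivative formula holds on the whole neighbourhood \<open>S\<close>, so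
  \<open>deriv (entropy n f)\<close> may be replaced near \<open>t\<close> by an explicit sum and
  differentiated termwise.\<close>

lemma deriv_deriv_entropy:
  fixes f d :: "nat \<Rightarrow> real \<Rightarrow> real"
  assumes "open S" "t \<in> S"
    and f: "\<And>k s. k \<le> n \<Longrightarrow> s \<in> S \<Longrightarrow> (f k has_real_derivative d k s) (at s)"
    and pos: "\<And>k s. k \<le> n \<Longrightarrow> s \<in> S \<Longrightarrow> 0 < f k s"
    and d: "\<And>k. k \<le> n \<Longrightarrow> (d k has_real_derivative d2 k) (at t)"
  shows "deriv (deriv (entropy n f)) t
    = - (\<Sum>k\<le>n. (ln (f k t) + 1) * d2 k) - (\<Sum>k\<le>n. (d k t)\<^sup>2 / f k t)"
proof -
  let ?E = "\<lambda>s. - (\<Sum>k\<le>n. d k s * (ln (f k s) + 1))"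
  have "(?E has_real_derivative
      - (\<Sum>k\<le>n. (ln (f k t) + 1) * d2 k + (d k t)\<^sup>2 / f k t)) (at t)"
    using assms(2) f pos d
    by (intro DERIV_minus DERIV_sum)
      (auto intro!: derivative_eq_intros simp: power2_eq_square algebra_simps)
  moreover have "\<forall>\<^sub>F s in nhds t. ?E s = deriv (entropy n f) s"
    using eventually_nhds_in_open[OF assms(1,2)]
    by eventually_elim
      (rule DERIV_imp_deriv[OF has_real_derivative_entropy, symmetric]; use f pos in blast)
  ultimately have "(deriv (entropy n f) has_real_derivative
      - (\<Sum>k\<le>n. (ln (f k t) + 1) * d2 k + (d k t)\<^sup>2 / f k t)) (at t)"
    by (simp add: DERIV_cong_ev[OF refl _ refl])
  from DERIV_imp_deriv[OF this] show ?thesis by (simp add: sum.distrib)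
qed

theorem theorem1p2:
  fixes n :: nat and v :: real and \<alpha> f :: "nat \<Rightarrow> real \<Rightarrow> real" and ts :: real
  assumes "n \<ge> 1"
    and "v > 0"
    and "constant_speed_path n v \<alpha> f"
    and "\<forall>k\<le>n. \<forall>t\<in>{0..1}. f k t > 0"
    and "\<forall>k\<le>n. C2_on_real {0..1} (f k)"
    and "\<forall>k\<le>n. C1_on_real {0..1} (\<alpha> k)"
    and "0 < ts" and "ts < 1"
    and "\<forall>k<n. \<alpha> k ts \<le> \<alpha> (Suc k) ts"
    and "\<forall>k\<le>n. deriv (\<alpha> k) ts \<ge> 0"
    and "\<forall>k. k + 2 \<le> n \<longrightarrow>
           \<alpha> (k+1) ts * (1 - \<alpha> (k+1) ts) * (f (k+1) ts)\<^sup>2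
           - \<alpha> (k+2) ts * (1 - \<alpha> k ts) * f k ts * f (k+2) ts \<ge> 0"
  shows "deriv (deriv (entropy n f)) ts \<le> 0"
proof -
  obtain m where n: "n = Suc m" using assms(1) by (cases n) auto
  have at_eq: "at t within {0..1} = at t" if "t \<in> {0<..<1}" for t :: real
    using that by (intro at_within_interior) auto
  have ts: "ts \<in> {0<..<1}" using assms(7,8) by simp
  define d where "d k t = - v * nabla_flux n \<alpha> f k t" for k t
  have f_deriv: "(f k has_real_derivative d k t) (at t)" if "k \<le> n" "t \<in> {0<..<1}" for k t
  proof -
    have "t \<in> {0..1}" using that by simp
    then show ?thesis
      using assms(3) that(1) unfolding constant_speed_path_def d_def at_eq[OF that(2), symmetric]
      by blast
  qed
  have pos: "0 < f k t" if "k \<le> n" "t \<in> {0<..<1}" for k t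
    using assms(4) that by simp
  have range01: "0 \<le> \<alpha> k t \<and> \<alpha> k t \<le> 1" if "k \<le> n" "t \<in> {0..1}" for k t
    using assms(3) that by (auto simp: constant_speed_path_def coeff_class_def)
  have ends: "\<alpha> 0 ts = 0" "\<alpha> n ts = 1"
    using assms(3) ts by (auto simp: constant_speed_path_def coeff_class_def)
  define \<alpha>' where "\<alpha>' k = deriv (\<alpha> k) ts" for k
  have \<alpha>_deriv: "(\<alpha> k has_real_derivative \<alpha>' k) (at ts)" if k: "k \<le> n" for k
  proof -
    have "ts \<in> {0..1}" using ts by simp
    with assms(6) k obtain D where "(\<alpha> k has_real_derivative D) (at ts)"
      unfolding C1_on_real_def at_eq[OF ts, symmetric] by blast
    then show ?thesis unfolding \<alpha>'_def by (simp add: DERIV_imp_deriv)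
  qed
  have \<alpha>'_0: "\<alpha>' k = 0" if "k \<le> n" "\<alpha> k ts = 0 \<or> \<alpha> k ts = 1" for k
    using deriv_eq_0_at_boundary_value[OF \<alpha>_deriv] that range01 assms(7,8) by blast

  define F where "F k = f k ts" for k
  define A where "A k = \<alpha> k ts" for k
  define G where "G k = flux n \<alpha> f k ts" for k
  define P where "P k = (if k = 0 then 0 else G (k - 1))" for k
  \<comment> \<open>The index is shifted: \<open>h (Suc k)\<close> is the h_k of the overview. The
    shift lets \<open>H\<close> run over 0..n and vanish at both ends.\<close>
  define h where "h k = A k * G k + (1 - A k) * P k" for k
  define H where "H k = h k - \<alpha>' k * F k / v" for k
  have d_ts: "d k ts = - v * (G k - P k)" for k
    by (simp add: d_def nabla_flux_def G_def P_def)
  have Gn: "G n = 0" by (simp add: G_def flux_def)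
  have G: "G k = A (Suc k) * F (Suc k) + (1 - A k) * F k" if "k < n" for k
    using that by (simp add: G_def A_def F_def flux_def)
  have H0: "H 0 = 0" and Hn: "H n = 0"
    using ends \<alpha>'_0[of 0] \<alpha>'_0[of n] by (auto simp: H_def h_def P_def Gn A_def)

  \<comment> \<open>Time derivative of the flux\<close>
  define G' where "G' k = (if k < n then - v * (H (Suc k) - H k) else 0)" for k
  have flux_deriv: "(flux n \<alpha> f k has_real_derivative G' k) (at ts)" for k
  proof (cases "k < n")
    case True
    have "((\<lambda>t. \<alpha> (Suc k) t * f (Suc k) t + (1 - \<alpha> k t) * f k t) has_real_derivative
        (\<alpha>' (Suc k) * F (Suc k) + d (Suc k) ts * A (Suc k)) +
        ((0 - \<alpha>' k) * F k + d k ts * (1 - A k))) (at ts)"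
      unfolding F_def A_def using True ts
      by (intro DERIV_add DERIV_mult DERIV_diff DERIV_const \<alpha>_deriv f_deriv) auto
    \<comment> \<open>Write \<open>h (Suc k)\<close> as
      \<open>G k + A (Suc k) * (G (Suc k) - G k)\<close> and \<open>h k\<close> as
      \<open>G k - (1 - A k) * (G k - P k)\<close>; their difference matches the terms from the
      derivatives of \<open>f\<close>.\<close>
    also have "(\<alpha>' (Suc k) * F (Suc k) + d (Suc k) ts * A (Suc k)) +
        ((0 - \<alpha>' k) * F k + d k ts * (1 - A k)) = G' k"
      using True assms(2) unfolding G'_def H_def h_def d_ts
      by (simp add: P_def field_simps)
    finally show ?thesis using True by (simp add: flux_def[abs_def])
  next
    case False
    then show ?thesis by (simp add: flux_def[abs_def] G'_def)
  qed
  define d2 where "d2 k = - v * (G' k - (if k = 0 then 0 else G' (k - 1)))" for k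
  have d_deriv: "(d k has_real_derivative d2 k) (at ts)" for k
  proof -
    have "((\<lambda>t. - v * (flux n \<alpha> f k t - (if k = 0 then 0 else flux n \<alpha> f (k - 1) t)))
        has_real_derivative d2 k) (at ts)"
      unfolding d2_def by (intro DERIV_cmult DERIV_diff) (auto simp: flux_deriv)
    then show ?thesis by (simp add: d_def[abs_def] nabla_flux_def[abs_def])
  qed

  \<comment> \<open>Logarithmic part of the second derivative\<close>
  define c where "c k = ln (F k) + 1" for k
  let ?L = "\<lambda>k. ln ((F (Suc k))\<^sup>2 / (F k * F (k + 2)))"
  have F: "0 < F k" if "k \<le> n" for k using pos[OF that ts] by (simp add: F_def)
  have L: "c (Suc k) - c k - (c (k + 2) - c (Suc k)) = ?L k" if "k < m" for k
    using F[of k] F[of "Suc k"] F[of "k + 2"] that n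
    by (simp add: c_def ln_div ln_mult ln_realpow)
  have "(\<Sum>k\<le>n. c k * d2 k) = - v * (\<Sum>k\<le>n. c k * (G' k - (if k = 0 then 0 else G' (k - 1))))"
    by (simp add: d2_def sum_distrib_left mult.left_commute)
  also have "\<dots> = - v * (\<Sum>k<n. G' k * (c k - c (Suc k)))"
    unfolding sum_by_parts_backward_diff by (simp add: G'_def)
  also have "\<dots> = v\<^sup>2 * (\<Sum>k<n. (H (Suc k) - H k) * (c k - c (Suc k)))"
    by (simp add: sum_distrib_left G'_def power2_eq_square mult.assoc)
  also have "\<dots> = v\<^sup>2 * (\<Sum>k<m. H (Suc k) * - ?L k)"
  proof -
    \<comment> \<open>The boundary terms drop out because \<open>H 0 = H n = 0\<close>.\<close>
    have "(\<Sum>k<n. (H (Suc k) - H k) * (c k - c (Suc k)))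
        = (\<Sum>k<m. H (Suc k) * (c k - c (Suc k) - (c (Suc k) - c (Suc (Suc k)))))"
      using sum_by_parts_forward_diff[of H "\<lambda>k. c k - c (Suc k)" m] H0 Hn by (simp add: n)
    also have "\<dots> = (\<Sum>k<m. H (Suc k) * - ?L k)"
      using L by (intro sum.cong refl arg_cong2[of _ _ _ _ "(*)"])
        (smt (verit) lessThan_iff add_2_eq_Suc')
    finally show ?thesis by simp
  qed
  finally have second: "- (\<Sum>k\<le>n. c k * d2 k) = v\<^sup>2 * (\<Sum>k<m. H (Suc k) * ?L k)"
    by (simp add: sum_negf)

  \<comment> \<open>Local bounds and their sum\<close>
  have local_bound: "H (Suc k) * ?L k
      \<le> (G k)\<^sup>2 / F k + (G (Suc k))\<^sup>2 / F (k + 2) - 2 * G k * G (Suc k) / F (Suc k)"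
    if k: "k < m" for k
  proof -
    have Fs: "0 < F k" "0 < F (Suc k)" "0 < F (k + 2)" using F k n by auto
    have As: "0 \<le> A k" "A k \<le> A (Suc k)" "A (Suc k) \<le> A (k + 2)" "A (k + 2) \<le> 1"
      using range01[of _ ts] ts assms(9) k n by (auto simp: A_def)
    have glc: "A (k + 2) * (1 - A k) * F k * F (k + 2) \<le> A (Suc k) * (1 - A (Suc k)) * (F (Suc k))\<^sup>2"
      using assms(11)[rule_format, of k] k n by (simp add: A_def F_def)
    have Gs: "G k = A (Suc k) * F (Suc k) + (1 - A k) * F k"
      "G (Suc k) = A (k + 2) * F (k + 2) + (1 - A (Suc k)) * F (Suc k)"
      using G[of k] G[of "Suc k"] k n by auto
    \<comment> \<open>This sign lets \<open>H\<close> be replaced by \<open>h\<close>. For an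
      interior coefficient, t-monotonicity combines with log-concavity; at the values 0 and 1 the
      derivative vanishes.\<close>
    have "0 \<le> \<alpha>' (Suc k) * ?L k"
    proof (cases "0 < A (Suc k) \<and> A (Suc k) < 1")
      case True
      then have "F k * F (k + 2) \<le> (F (Suc k))\<^sup>2"
        using GLC_imp_ratio_bounds(3)[OF Fs As _ _ glc] by blast
      then have "0 \<le> ?L k" using Fs by simp
      then show ?thesis using assms(10) k n by (simp add: \<alpha>'_def)
    next
      case False
      then have "\<alpha>' (Suc k) = 0" using \<alpha>'_0[of "Suc k"] As k n by (force simp: A_def)
      then show ?thesis by simp
    qed
    then have "0 \<le> F (Suc k) / v * (\<alpha>' (Suc k) * ?L k)"
      using Fs assms(2) by (intro mult_nonneg_nonneg[of "F (Suc k) / v"]) auto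
    then have "H (Suc k) * ?L k \<le> h (Suc k) * ?L k"
      by (simp add: H_def algebra_simps)
    also have "h (Suc k) = A (Suc k) * G (Suc k) + (1 - A (Suc k)) * G k"
      by (simp add: h_def P_def)
    also note flux_log_bound[OF Fs As glc Gs]
    finally show ?thesis .
  qed

  have "(\<Sum>k<m. H (Suc k) * ?L k)
      \<le> (\<Sum>k<m. (G k)\<^sup>2 / F k + (G (Suc k))\<^sup>2 / F (k + 2) - 2 * G k * G (Suc k) / F (Suc k))"
    using local_bound by (intro sum_mono) auto
  \<comment> \<open>The nonnegative leftover end terms are discarded.\<close>
  also have "\<dots> \<le> (\<Sum>k\<le>m. (G k - P k)\<^sup>2 / F k) + (G m)\<^sup>2 / F (Suc m)"
    using sum_sq_backward_diff[of G F m] F[of m] F[of 1] n by (simp add: P_def)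
  \<comment> \<open>Since \<open>G n = 0\<close> and \<open>P n = G m\<close>, the extra term is the
    summand at \<open>k = n\<close>.\<close>
  also have "\<dots> = (\<Sum>k\<le>n. (G k - P k)\<^sup>2 / F k)"
    using Gn by (simp add: n P_def)
  finally have "v\<^sup>2 * (\<Sum>k<m. H (Suc k) * ?L k) \<le> v\<^sup>2 * (\<Sum>k\<le>n. (G k - P k)\<^sup>2 / F k)"
    by (intro mult_left_mono) auto
  also have "\<dots> = (\<Sum>k\<le>n. (d k ts)\<^sup>2 / F k)"
    by (simp add: d_ts sum_distrib_left power_mult_distrib)
  finally have "- (\<Sum>k\<le>n. c k * d2 k) - (\<Sum>k\<le>n. (d k ts)\<^sup>2 / F k) \<le> 0"
    using second by simp
  moreover have "deriv (deriv (entropy n f)) ts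
      = - (\<Sum>k\<le>n. c k * d2 k) - (\<Sum>k\<le>n. (d k ts)\<^sup>2 / F k)"
    unfolding c_def F_def
    by (rule deriv_deriv_entropy[OF open_greaterThanLessThan ts]) (auto intro: f_deriv pos d_deriv)
  ultimately show ?thesis by simp
qed

end
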